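(* If $n\ge 4$, then $\mathrm{vv}(P_n\,\square\,P_n)=\dfrac{n^2+n-2}{2}$.
   Context: $P_n$ is the path on $n$ vertices. The Cartesian product $G\,\square\,H$ has vertex set $V(G)\times V(H)$, with $(g,h)$ adjacent to $(g',h')$ iff either $gg'\in E(G)$ and $h=h'$, or $g=g'$ and $hh'\in E(H)$. For a connected graph $X$ and $x\in V(X)$, a set $S\subseteq V(X)\setminus\{x\}$ is an $x$-visibility set if for every $y\in S$ there exists a shortest $x,y$-path $P$ with $V(P)\cap S=\{y\}$; $v_x(X)$ is the maximum size of an $x$-visibility set and $\mathrm{vv}(X)=\max_{x\in V(X)} v_x(X)$. *)

theory Defs
  imports Complex_Main "Graph_Theory.Graph_Theory"
begin

(* Simple graphs are the locale pair_graph: finite loop-free digraphs whose set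
   of arcs is symmetric, an edge uv being the two arcs (u, v) and (v, u). *)

definition path_graph :: "nat \<Rightarrow> nat pair_pre_digraph" where
  "path_graph n =
     \<lparr>pverts = {..<n}, parcs = {(i, j). i < n \<and> j < n \<and> (j = Suc i \<or> i = Suc j)}\<rparr>"

definition cartesian_product ::
  "'a pair_pre_digraph \<Rightarrow> 'b pair_pre_digraph \<Rightarrow> ('a \<times> 'b) pair_pre_digraph"
  (infixl "\<box>" 70) where
  "G \<box> H =
     \<lparr>pverts = pverts G \<times> pverts H,
      parcs = {((g, h), (g', h')).
        (g, g') \<in> parcs G \<and> h = h' \<and> h \<in> pverts H \<or>
        g = g' \<and> g \<in> pverts G \<and> (h, h') \<in> parcs H}\<rparr>"

lemma pair_graph_path_graph: "pair_graph (path_graph n)"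
proof
  show "finite (parcs (path_graph n))"
    by (rule finite_subset[of _ "{..<n} \<times> {..<n}"]) (auto simp: path_graph_def)
qed (auto simp: path_graph_def symmetric_def sym_def)

lemma pair_graph_cartesian_product:
  assumes "pair_graph G" "pair_graph H"
  shows "pair_graph (G \<box> H)"
proof -
  interpret G: pair_graph G by fact
  interpret H: pair_graph H by fact
  have Gv: "(a, b) \<in> parcs G \<Longrightarrow> a \<in> pverts G \<and> b \<in> pverts G" for a b
    using G.arc_fst_in_verts[of "(a, b)"] G.arc_snd_in_verts[of "(a, b)"] by simp
  have Hv: "(a, b) \<in> parcs H \<Longrightarrow> a \<in> pverts H \<and> b \<in> pverts H" for a b
    using H.arc_fst_in_verts[of "(a, b)"] H.arc_snd_in_verts[of "(a, b)"] by simp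
  have wf: "e \<in> parcs (G \<box> H) \<Longrightarrow> fst e \<in> pverts (G \<box> H) \<and> snd e \<in> pverts (G \<box> H)" for e
    using Gv Hv by (auto simp: cartesian_product_def)
  have fin: "finite (pverts (G \<box> H))"
    using G.pair_finite_verts H.pair_finite_verts by (simp add: cartesian_product_def)
  show ?thesis
  proof
    have "parcs (G \<box> H) \<subseteq> pverts (G \<box> H) \<times> pverts (G \<box> H)"
      using wf by (metis mem_Times_iff subsetI)
    then show "finite (parcs (G \<box> H))"
      using fin by (meson finite_SigmaI finite_subset)
  next
    show "symmetric (with_proj (G \<box> H))"
      using G.pair_sym_arcs H.pair_sym_arcs
      by (auto simp: symmetric_def sym_def cartesian_product_def)
  next
    show "fst e \<noteq> snd e" if "e \<in> parcs (G \<box> H)" for e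
      using that G.pair_no_loops H.pair_no_loops by (fastforce simp: cartesian_product_def)
  qed (use wf fin in auto)
qed

definition shortest_path :: "'a pair_pre_digraph \<Rightarrow> 'a \<Rightarrow> 'a list \<Rightarrow> 'a \<Rightarrow> bool" where
  "shortest_path X x p y \<longleftrightarrow>
     vpath p X \<and> hd p = x \<and> last p = y \<and>
     (\<forall>q. vpath q X \<and> hd q = x \<and> last q = y \<longrightarrow> vwalk_length p \<le> vwalk_length q)"

definition visibility_set :: "'a pair_pre_digraph \<Rightarrow> 'a \<Rightarrow> 'a set \<Rightarrow> bool" where
  "visibility_set X x S \<longleftrightarrow>
     S \<subseteq> pverts X - {x} \<and> (\<forall>y\<in>S. \<exists>p. shortest_path X x p y \<and> set p \<inter> S = {y})"

definition vertex_visibility :: "'a pair_pre_digraph \<Rightarrow> 'a \<Rightarrow> nat" where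
  "vertex_visibility X x = Max {card S |S. visibility_set X x S}"

(* Both maxima are over finite nonempty sets when X is a nonempty finite graph:
   the empty set is a visibility set for every vertex. *)
definition vv :: "'a pair_pre_digraph \<Rightarrow> nat" where
  "vv X = Max (vertex_visibility X ` pverts X)"

lemma finite_card_visibility_sets:
  assumes "finite (pverts X)"
  shows "finite {card S |S. visibility_set X x S}" "{card S |S. visibility_set X x S} \<noteq> {}"
proof -
  have "{card S |S. visibility_set X x S} \<subseteq> card ` Pow (pverts X)"
    by (auto simp: visibility_set_def)
  then show "finite {card S |S. visibility_set X x S}"
    using assms by (meson finite_Pow_iff finite_imageI finite_subset)
  have "visibility_set X x {}" by (simp add: visibility_set_def)
  then show "{card S |S. visibility_set X x S} \<noteq> {}" by blast
qed

end

(*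
  Fix x and S, and let R be the set of vertices outside S that x sees along geodesics avoiding S.
  Every vertex of S and every vertex of R other than x has a neighbour in R that is closer to x.
  Counting these pairs in the four quadrants around x and telescoping along rows and columns
  bounds |S| in terms of the number of vertices of R on the four arms through x, minus the number
  of defects: vertices with both or neither of their two closer neighbours in R, and vertices of R
  on the border. Without a defect, the vertices of an antidiagonal alternate between R and
  its complement, so the parity of the length of the antidiagonal enforces defects; summed over the
  quadrants there are enough of them to give 2 |S| <= n^2 + n - 1, and n^2 + n is even.
  The bound is attained for x = (1, 1).
*)
theory Submission
  imports Defs
begin

subsection \<open>Geodesics in the grid\<close>

abbreviation grid :: "nat \<Rightarrow> (nat \<times> nat) pair_pre_digraph" where
  "grid n \<equiv> path_graph n \<box> path_graph n"

text \<open>Manhattan distance: subtraction of naturals truncates, so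
  \<open>(a - b) + (b - a)\<close> is the absolute difference.\<close>

definition grid_dist :: "nat \<times> nat \<Rightarrow> nat \<times> nat \<Rightarrow> nat" where
  "grid_dist u v =
     (fst u - fst v) + (fst v - fst u) + ((snd u - snd v) + (snd v - snd u))"

lemma grid_dist_self [simp]: "grid_dist u u = 0"
  by (simp add: grid_dist_def)

lemma grid_dist_triangle: "grid_dist u w \<le> grid_dist u v + grid_dist v w"
proof -
  have "(a - c) + (c - a) \<le> (a - b) + (b - a) + ((b - c) + (c - b))" for a b c :: nat
    by (cases "a \<le> b"; cases "b \<le> c"; cases "a \<le> c"; simp)
  from add_mono[OF this[of "fst u" "fst w" "fst v"] this[of "snd u" "snd w" "snd v"]]
  show ?thesis by (simp add: grid_dist_def)
qed

lemma pverts_grid: "pverts (grid n) = {..<n} \<times> {..<n}"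
  by (simp add: cartesian_product_def path_graph_def)

lemma parcs_grid:
  "(u, v) \<in> parcs (grid n) \<longleftrightarrow>
     u \<in> pverts (grid n) \<and> v \<in> pverts (grid n) \<and> grid_dist u v = 1"
  by (cases u; cases v) (auto simp: cartesian_product_def path_graph_def grid_dist_def)

lemma vwalk_snoc_iff:
  assumes "p \<noteq> []"
  shows "vwalk (p @ [v]) G \<longleftrightarrow> vwalk p G \<and> v \<in> verts G \<and> (last p, v) \<in> arcs_ends G"
  using assms by (auto simp: vwalk_def vwalk_arcs_append)

text \<open>Each arc changes the distance by at most one. Covering every vertex of the walk, not
  only its end, lets \<open>geodesic_distinct\<close> exclude repetitions.\<close>

lemma grid_dist_vwalk:
  assumes "vwalk p (grid n)" "w \<in> set p"
  shows "grid_dist (hd p) w < length p"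
  using assms
proof (induction p arbitrary: w rule: rev_induct)
  case (snoc v p)
  show ?case
  proof (cases "p = []")
    case False
    then have walk: "vwalk p (grid n)" and arc: "grid_dist (last p) v = 1"
      using snoc.prems(1) by (auto simp: vwalk_snoc_iff parcs_grid)
    have "grid_dist (hd p) (last p) < length p"
      using snoc.IH walk False by simp
    then have "grid_dist (hd p) v < Suc (length p)"
      using grid_dist_triangle[of "hd p" v "last p"] arc by simp
    moreover have "grid_dist (hd p) w < length p" if "w \<in> set p"
      using snoc.IH[OF walk that] .
    ultimately show ?thesis
      using snoc.prems(2) False by auto
  qed (use snoc.prems in auto)
qed simp

text \<open>Stated for walks, so that appending a vertex needs no check of distinctness;
  \<open>geodesic_distinct\<close> supplies it.\<close>

definition geodesic :: "nat \<Rightarrow> nat \<times> nat \<Rightarrow> (nat \<times> nat) list \<Rightarrow> nat \<times> nat \<Rightarrow> bool" where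
  "geodesic n x p y \<longleftrightarrow>
     vwalk p (grid n) \<and> hd p = x \<and> last p = y \<and> length p = Suc (grid_dist x y)"

definition closer :: "nat \<times> nat \<Rightarrow> nat \<times> nat \<Rightarrow> nat \<times> nat \<Rightarrow> bool" where
  "closer x u v \<longleftrightarrow> grid_dist u v = 1 \<and> grid_dist x v = Suc (grid_dist x u)"

lemma geodesic_self: "x \<in> pverts (grid n) \<Longrightarrow> geodesic n x [x] x"
  by (auto simp: geodesic_def)

lemma geodesic_snoc:
  assumes "geodesic n x p u" "v \<in> pverts (grid n)" "closer x u v"
  shows "geodesic n x (p @ [v]) v"
proof -
  have "p \<noteq> []" using assms(1) by (auto simp: geodesic_def)
  moreover have "u \<in> pverts (grid n)"
    using assms(1) calculation by (auto simp: geodesic_def vwalk_def)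
  ultimately show ?thesis
    using assms by (auto simp: geodesic_def closer_def vwalk_snoc_iff parcs_grid)
qed

lemma geodesic_cases:
  assumes "geodesic n x p v" "v \<noteq> x"
  obtains q u where "p = q @ [v]" "geodesic n x q u" "closer x u v"
proof -
  have "p \<noteq> []" using assms(1) by (auto simp: geodesic_def)
  then have p: "p = butlast p @ [v]"
    using assms(1) by (metis append_butlast_last_id geodesic_def)
  define q where "q = butlast p"
  have ne: "q \<noteq> []"
  proof
    assume "q = []"
    then have "hd p = v" using p unfolding q_def by (metis append_Nil list.sel(1))
    then show False using assms by (simp add: geodesic_def)
  qed
  have walk: "vwalk q (grid n)" and arc: "grid_dist (last q) v = 1"
    and hd: "hd q = x" and len: "length q = grid_dist x v"
    using assms(1) p ne unfolding q_def[symmetric]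
    by (auto simp: geodesic_def vwalk_snoc_iff parcs_grid)
  have "grid_dist x (last q) < length q"
    using grid_dist_vwalk[OF walk, of "last q"] ne hd by simp
  then have "grid_dist x v = Suc (grid_dist x (last q))"
    using grid_dist_triangle[of x v "last q"] arc len by simp
  then show thesis
    using that[of q "last q"] p walk arc hd len
    by (simp add: geodesic_def closer_def q_def)
qed

lemma geodesic_distinct: "geodesic n x p v \<Longrightarrow> distinct p"
proof (induction "grid_dist x v" arbitrary: p v rule: less_induct)
  case less
  show ?case
  proof (cases "v = x")
    case True
    then have "length p = 1" using less.prems by (simp add: geodesic_def)
    then show ?thesis by (metis One_nat_def distinct_conv_nth less_one)
  next
    case False
    then obtain q u where q: "p = q @ [v]" "geodesic n x q u" "closer x u v"
      using geodesic_cases less.prems by blast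
    have "v \<notin> set q"
      using q(2,3) grid_dist_vwalk[of q n v] by (auto simp: geodesic_def closer_def)
    moreover have "distinct q"
      using less.hyps[of u q] q(2,3) by (simp add: closer_def)
    ultimately show ?thesis using q(1) by simp
  qed
qed

lemma closer_exists:
  assumes "x \<in> pverts (grid n)" "v \<in> pverts (grid n)" "v \<noteq> x"
  obtains u where "u \<in> pverts (grid n)" "closer x u v"
proof -
  obtain a b c d where xv: "x = (a, b)" "v = (c, d)" by (cases x; cases v)
  define u where
    "u = (if c < a then (c + 1, d) else if a < c then (c - 1, d)
          else if d < b then (c, d + 1) else (c, d - 1))"
  have "u \<in> pverts (grid n)" "closer x u v"
    using assms by (auto simp: u_def xv pverts_grid closer_def grid_dist_def)
  then show thesis using that by blast
qed

lemma geodesic_exists: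
  assumes "x \<in> pverts (grid n)" "v \<in> pverts (grid n)"
  shows "\<exists>p. geodesic n x p v"
  using assms(2)
proof (induction "grid_dist x v" arbitrary: v rule: less_induct)
  case less
  show ?case
  proof (cases "v = x")
    case True
    then show ?thesis using geodesic_self assms(1) by blast
  next
    case False
    then obtain u where u: "u \<in> pverts (grid n)" "closer x u v"
      using closer_exists assms(1) less.prems by blast
    then show ?thesis
      using less geodesic_snoc unfolding closer_def by (metis lessI)
  qed
qed

text \<open>A geodesic to \<open>y\<close> exists and no walk to \<open>y\<close> is shorter, so
  minimality amounts to having the explicit length.\<close>

lemma shortest_path_grid:
  assumes "x \<in> pverts (grid n)"
  shows "shortest_path (grid n) x p y \<longleftrightarrow> geodesic n x p y"
proof
  assume *: "geodesic n x p y"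
  have "vwalk_length p \<le> vwalk_length q"
    if "vpath q (grid n)" "hd q = x" "last q = y" for q
  proof -
    have "q \<noteq> []" using that by (auto simp: vpath_def)
    then have "grid_dist x y < length q"
      using grid_dist_vwalk[of q n y] that by (auto simp: vpath_def)
    then show ?thesis using * by (simp add: geodesic_def)
  qed
  then show "shortest_path (grid n) x p y"
    using * geodesic_distinct[OF *] by (auto simp: shortest_path_def geodesic_def vpath_def)
next
  assume *: "shortest_path (grid n) x p y"
  then have walk: "vwalk p (grid n)" "hd p = x" "last p = y" "p \<noteq> []"
    by (auto simp: shortest_path_def vpath_def)
  then have "y \<in> pverts (grid n)" by (auto simp: vwalk_def)
  then obtain q where q: "geodesic n x q y" using geodesic_exists assms by blast
  then have "vwalk_length p \<le> vwalk_length q"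
    using * geodesic_distinct[OF q] by (auto simp: shortest_path_def geodesic_def vpath_def)
  moreover have "grid_dist x y < length p"
    using grid_dist_vwalk[of p n y] walk by auto
  ultimately show "geodesic n x p y" using q walk by (auto simp: geodesic_def)
qed

text \<open>The set \<open>R\<close> consists of the vertices outside \<open>S\<close> that \<open>x\<close> sees along \<open>S\<close>-avoiding geodesics.\<close>

lemma visibility_set_grid_iff:
  assumes x: "x \<in> pverts (grid n)"
  shows "visibility_set (grid n) x S \<longleftrightarrow>
    S \<subseteq> pverts (grid n) - {x} \<and>
    (\<exists>R. R \<subseteq> pverts (grid n) \<and> x \<in> R \<and> R \<inter> S = {} \<and>
         (\<forall>v\<in>R \<union> S. v \<noteq> x \<longrightarrow> (\<exists>u\<in>R. closer x u v)))"
    (is "?vis \<longleftrightarrow> ?sub \<and> ?reach")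
proof
  assume vis: ?vis
  then have sub: ?sub by (simp add: visibility_set_def)
  define R where "R = {v. \<exists>p. geodesic n x p v \<and> set p \<inter> S = {}}"
  have "set [x] \<inter> S = {}" using sub by auto
  then have "x \<in> R"
    unfolding R_def mem_Collect_eq by (intro exI[of _ "[x]"] conjI geodesic_self x)
  have R: "v \<notin> S \<and> v \<in> pverts (grid n)" if v: "v \<in> R" for v
  proof -
    obtain p where p: "geodesic n x p v" "set p \<inter> S = {}"
      using v unfolding R_def mem_Collect_eq by (elim exE conjE)
    have "p \<noteq> []" using p(1) by (auto simp: geodesic_def)
    then have "v \<in> set p" "set p \<subseteq> pverts (grid n)"
      using p(1) last_in_set[of p] by (auto simp: geodesic_def vwalk_def)
    then show ?thesis using p(2) by (meson disjoint_iff subsetD)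
  qed
  have "\<exists>u\<in>R. closer x u v" if v: "v \<in> R \<union> S" "v \<noteq> x" for v
  proof -
    have "\<exists>p. geodesic n x p v \<and> set p \<inter> S \<subseteq> {v}"
    proof (cases "v \<in> S")
      case True
      then have "\<exists>p. geodesic n x p v \<and> set p \<inter> S = {v}"
        using vis by (simp add: visibility_set_def shortest_path_grid[OF x])
      then show ?thesis by (metis order_refl)
    next
      case False
      then have "v \<in> R" using v(1) by simp
      then show ?thesis unfolding R_def mem_Collect_eq by (metis empty_subsetI)
    qed
    then obtain p where p: "geodesic n x p v" "set p \<inter> S \<subseteq> {v}" by (elim exE conjE)
    obtain q u where q: "p = q @ [v]" "geodesic n x q u" "closer x u v"
      using geodesic_cases[OF p(1) v(2)] .
    \<comment> \<open>\<open>p\<close> meets \<open>S\<close> at most in its end \<open>v\<close>,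
      and distinctness keeps \<open>v\<close> out of \<open>q\<close>.\<close>
    then have "set q \<inter> S = {}" using p(2) geodesic_distinct[OF p(1)] by auto
    then have "u \<in> R" unfolding R_def mem_Collect_eq using q(2) by (intro exI[of _ q] conjI)
    then show ?thesis using q(3) by (rule bexI[rotated])
  qed
  then show "?sub \<and> ?reach" using sub \<open>x \<in> R\<close> R by (intro conjI exI[of _ R] ballI impI) auto
next
  assume *: "?sub \<and> ?reach"
  then obtain R where R: "R \<subseteq> pverts (grid n)" "x \<in> R" "R \<inter> S = {}"
    "\<And>v. v \<in> R \<union> S \<Longrightarrow> v \<noteq> x \<Longrightarrow> \<exists>u\<in>R. closer x u v" by blast
  \<comment> \<open>For the converse any \<open>R\<close> with these properties will do: chaining
    closer vertices inside \<open>R\<close> gives a geodesic that avoids \<open>S\<close> before its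
    end.\<close>
  have reach: "\<exists>p. geodesic n x p v \<and> set p \<subseteq> insert v R" if "v \<in> R \<union> S" for v
    using that
  proof (induction "grid_dist x v" arbitrary: v rule: less_induct)
    case less
    show ?case
    proof (cases "v = x")
      case True
      then show ?thesis using geodesic_self[OF x] by (intro exI[of _ "[x]"]) simp
    next
      case False
      then obtain u where u: "u \<in> R" "closer x u v" using R(4) less.prems by blast
      then obtain p where "geodesic n x p u" "set p \<subseteq> R"
        using less.hyps[of u] by (auto simp: closer_def insert_absorb)
      then show ?thesis
        using geodesic_snoc[of n x p u v] u less.prems R(1) *
        by (intro exI[of _ "p @ [v]"]) auto
    qed
  qed
  have "\<exists>p. geodesic n x p y \<and> set p \<inter> S = {y}" if y: "y \<in> S" for y
  proof -
    obtain p where p: "geodesic n x p y" "set p \<subseteq> insert y R" using reach y by blast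
    then have "y \<in> set p" by (auto simp: geodesic_def vwalk_def dest: last_in_set)
    then show ?thesis using p R(3) y by (intro exI[of _ p]) auto
  qed
  then show ?vis using * by (simp add: visibility_set_def shortest_path_grid[OF x])
qed

subsection \<open>Counting in a quadrant\<close>

text \<open>Without two equal consecutive values \<open>\<tau>\<close> alternates, and its ends
  agree exactly for even \<open>k\<close>.\<close>

lemma ex_equal_consecutive:
  fixes \<tau> :: "nat \<Rightarrow> bool"
  assumes "\<tau> (l + k) = \<tau> l \<longleftrightarrow> odd k"
  shows "\<exists>c\<in>{Suc l..l + k}. \<tau> (c - 1) = \<tau> c"
proof (rule ccontr)
  assume none: "\<not> ?thesis"
  have "(\<tau> (l + j) = \<tau> l) \<longleftrightarrow> even j" if "j \<le> k" for j
    using that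
  proof (induction j)
    case (Suc j)
    then have "\<tau> (l + j) \<noteq> \<tau> (l + Suc j)"
      using none by (auto dest: bspec[of _ _ "l + Suc j"])
    then show ?case using Suc by auto
  qed simp
  then show False using assms by blast
qed

lemma sum_diff_pred:
  fixes f :: "nat \<Rightarrow> int"
  shows "(\<Sum>c = 1..q. f (c - 1) - f c) = f 0 - f q"
  by (induction q) simp_all

text \<open>
  In a quadrant with corner \<open>x = (0, 0)\<close>, a vertex has the two neighbours \<open>(c - 1, y)\<close> and
  \<open>(c, y - 1)\<close> closer to \<open>x\<close>. A defect is a vertex whose two such neighbours are both reached
  or both not reached, where the vertices outside the grid count as reached and their
  defects are counted, too.
\<close>

definition defects :: "nat \<Rightarrow> nat \<Rightarrow> (nat \<Rightarrow> nat \<Rightarrow> bool) \<Rightarrow> int" where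
  "defects q p r =
     (\<Sum>c = 1..q. \<Sum>y = 1..p. of_bool (r (c - 1) y = r c (y - 1))) +
     (\<Sum>y = 1..p. of_bool (r q y)) + (\<Sum>c = 1..q. of_bool (r c p))"

text \<open>The pointwise inequality \<open>pt\<close> is summed over the quadrant. Its differences
  telescope along rows and columns, leaving the two arms on the right and the border terms of
  \<open>defects\<close> on the left.\<close>

lemma quadrant_count:
  fixes r s :: "nat \<Rightarrow> nat \<Rightarrow> bool"
  assumes r: "\<And>c y. 1 \<le> c \<Longrightarrow> c \<le> q \<Longrightarrow> 1 \<le> y \<Longrightarrow> y \<le> p \<Longrightarrow> r c y \<or> s c y \<Longrightarrow>
                r (c - 1) y \<or> r c (y - 1)"
    and s: "\<And>c y. c \<le> q \<Longrightarrow> y \<le> p \<Longrightarrow> s c y \<Longrightarrow> \<not> r c y"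
  shows "2 * (\<Sum>c = 1..q. \<Sum>y = 1..p. of_bool (s c y)) + defects q p r
    \<le> int q * int p + (\<Sum>c = 1..q. of_bool (r c 0)) + (\<Sum>y = 1..p. of_bool (r 0 y))"
proof -
  let ?I = "\<lambda>P. of_bool P :: int"
  \<comment> \<open>Both sides are equal whenever \<open>r c y\<close> or \<open>s c y\<close>
    holds.\<close>
  have pt: "2 * ?I (s c y) + ?I (r (c - 1) y = r c (y - 1)) \<le>
      1 + (?I (r (c - 1) y) - ?I (r c y)) + (?I (r c (y - 1)) - ?I (r c y))"
    if "c \<in> {1..q}" "y \<in> {1..p}" for c y
    using r[of c y] s[of c y] that by (auto split: if_splits)
  have "(\<Sum>c = 1..q. \<Sum>y = 1..p. 2 * ?I (s c y) + ?I (r (c - 1) y = r c (y - 1))) \<le>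
      (\<Sum>c = 1..q. \<Sum>y = 1..p.
         1 + (?I (r (c - 1) y) - ?I (r c y)) + (?I (r c (y - 1)) - ?I (r c y)))"
    by (intro sum_mono pt)
  also have "\<dots> = int q * int p + (\<Sum>c = 1..q. \<Sum>y = 1..p. ?I (r (c - 1) y) - ?I (r c y))
      + (\<Sum>c = 1..q. \<Sum>y = 1..p. ?I (r c (y - 1)) - ?I (r c y))"
    by (simp only: sum.distrib) simp
  also have "(\<Sum>c = 1..q. \<Sum>y = 1..p. ?I (r (c - 1) y) - ?I (r c y)) =
      (\<Sum>y = 1..p. ?I (r 0 y) - ?I (r q y))"
    by (subst sum.swap) (simp only: sum_diff_pred[of "\<lambda>c. ?I (r c _)"])
  also have "(\<Sum>c = 1..q. \<Sum>y = 1..p. ?I (r c (y - 1)) - ?I (r c y)) =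
      (\<Sum>c = 1..q. ?I (r c 0) - ?I (r c p))"
    by (simp only: sum_diff_pred[of "\<lambda>y. ?I (r _ y)"])
  finally show ?thesis
    by (simp add: defects_def sum.distrib sum_subtractf sum_distrib_left del: sum_of_bool_eq)
qed

section \<open>Lower bounds on the number of defects in a quadrant\<close>

lemma defects_swap: "defects p q (\<lambda>c y. r y c) = defects q p r"
proof -
  have "(\<Sum>y = 1..p. \<Sum>c = 1..q. of_bool (r c (y - 1) = r (c - 1) y)) =
      (\<Sum>c = 1..q. \<Sum>y = 1..p. of_bool (r (c - 1) y = r c (y - 1)) :: int)"
    by (subst sum.swap) (intro sum.cong refl arg_cong[of _ _ of_bool] eq_commute)
  then show ?thesis by (simp only: defects_def)
qed

text \<open>\<open>E\<close> makes all vertices beyond the border reached, which turns the border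
  terms of \<open>defects\<close> into defects at \<open>c = Suc q\<close> or
  \<open>y = Suc p\<close>. The closer neighbours of a vertex with \<open>c + y = Suc d\<close> lie
  on antidiagonal \<open>d\<close>, so different \<open>d\<close> give different defects. The corner
  \<open>(Suc q, Suc p)\<close> is always a defect, but belongs to \<open>d = p + q + 1\<close>,
  outside \<open>K\<close>.\<close>

lemma card_le_defects:
  fixes p q :: nat and r :: "nat \<Rightarrow> nat \<Rightarrow> bool"
  defines "E \<equiv> \<lambda>c y. q < c \<or> p < y \<or> r c y"
  assumes K: "K \<subseteq> {1..p + q}"
    and ex: "\<And>d. d \<in> K \<Longrightarrow> \<exists>c y. c + y = Suc d \<and> 1 \<le> c \<and> c \<le> Suc q \<and> 1 \<le> y \<and> y \<le> Suc p \<and>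
                                E (c - 1) y = E c (y - 1)"
  shows "int (card K) \<le> defects q p r"
proof -
  let ?I = "\<lambda>P. of_bool P :: int"
  define D where "D = {z \<in> {1..Suc q} \<times> {1..Suc p}. E (fst z - 1) (snd z) = E (fst z) (snd z - 1)}"
  have "int (card D) = (\<Sum>z\<in>{1..Suc q} \<times> {1..Suc p}. ?I (E (fst z - 1) (snd z) = E (fst z) (snd z - 1)))"
    by (simp add: D_def Int_def)
  also have "\<dots> = (\<Sum>c = 1..Suc q. \<Sum>y = 1..Suc p. ?I (E (c - 1) y = E c (y - 1)))"
    by (simp only: sum.cartesian_product split_def)
  also have "\<dots> = (\<Sum>c = 1..q. (\<Sum>y = 1..p. ?I (E (c - 1) y = E c (y - 1))) + ?I (E (c - 1) (Suc p) = E c p))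
      + ((\<Sum>y = 1..p. ?I (E q y = E (Suc q) (y - 1))) + ?I (E q (Suc p) = E (Suc q) p))"
    by (simp del: sum_of_bool_eq)
  also have "(\<Sum>c = 1..q. (\<Sum>y = 1..p. ?I (E (c - 1) y = E c (y - 1))) + ?I (E (c - 1) (Suc p) = E c p))
      = (\<Sum>c = 1..q. (\<Sum>y = 1..p. ?I (r (c - 1) y = r c (y - 1))) + ?I (r c p))"
    by (intro sum.cong arg_cong2[of _ _ _ _ "(+)"]) (auto simp: E_def)
  also have "(\<Sum>y = 1..p. ?I (E q y = E (Suc q) (y - 1))) = (\<Sum>y = 1..p. ?I (r q y))"
    by (intro sum.cong) (auto simp: E_def)
  finally have card_D: "int (card D) = defects q p r + 1"
    by (simp add: defects_def sum.distrib E_def)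
  have corner: "(Suc q, Suc p) \<in> D" by (simp add: D_def E_def)
  have "K \<subseteq> (\<lambda>z. fst z + snd z - 1) ` (D - {(Suc q, Suc p)})"
  proof
    fix d assume d: "d \<in> K"
    then obtain c y where cy: "c + y = Suc d" "1 \<le> c" "c \<le> Suc q" "1 \<le> y" "y \<le> Suc p"
      "E (c - 1) y = E c (y - 1)" using ex by blast
    then have "(c, y) \<in> D - {(Suc q, Suc p)}" using d K by (auto simp: D_def)
    moreover have "d = fst (c, y) + snd (c, y) - 1" using cy by simp
    ultimately show "d \<in> (\<lambda>z. fst z + snd z - 1) ` (D - {(Suc q, Suc p)})" by blast
  qed
  moreover have finD: "finite D" by (simp add: D_def)
  ultimately have "card K \<le> card (D - {(Suc q, Suc p)})"
    by (meson card_image_le card_mono finite_Diff finite_imageI order_trans)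
  then have "card K \<le> card D - 1" using corner by simp
  moreover have "1 \<le> card D" using corner finD by (simp add: Suc_le_eq card_gt_0_iff) blast
  ultimately show ?thesis using card_D by linarith
qed

text \<open>Consecutive vertices \<open>(c - 1, d - (c - 1))\<close> and \<open>(c, d - c)\<close>
  of antidiagonal \<open>d\<close> are the two closer neighbours of \<open>(c, Suc d - c)\<close>,
  so equal consecutive values are a defect there.\<close>

lemma ex_level_defect:
  fixes E :: "nat \<Rightarrow> nat \<Rightarrow> bool"
  assumes "l + k \<le> d" "E (l + k) (d - (l + k)) = E l (d - l) \<longleftrightarrow> odd k"
  shows "\<exists>c y. c + y = Suc d \<and> Suc l \<le> c \<and> c \<le> l + k \<and> E (c - 1) y = E c (y - 1)"
proof -
  obtain c where c: "Suc l \<le> c" "c \<le> l + k" "E (c - 1) (d - (c - 1)) = E c (d - c)"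
    using ex_equal_consecutive[of "\<lambda>c. E c (d - c)" l k, OF assms(2)]
    by (metis atLeastAtMost_iff)
  then show ?thesis
    using assms(1) by (intro exI[of _ c] exI[of _ "Suc d - c"]) auto
qed

lemma sum_of_bool_le:
  assumes "j \<le> q" "\<And>c. c \<le> q \<Longrightarrow> P c \<longleftrightarrow> c \<le> j"
  shows "(\<Sum>c = 1..q. of_bool (P c)) = int j"
proof -
  have "{1..q} \<inter> {c. P c} = {1..j}" using assms by auto
  then show ?thesis by simp
qed

text \<open>
  Here \<open>i\<close> and \<open>j\<close> count the reached vertices on the two arms of lengths \<open>p\<close> and \<open>q\<close> that
  border a quadrant. Behind them, an arm has at most one vertex of \<open>S\<close>, so \<open>p - i - 1\<close> and
  \<open>q - j - 1\<close> (truncated) vertices are wasted; \<open>v\<close> is the number of defects plus wasted vertices.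
\<close>

definition quadrant_bound :: "nat \<Rightarrow> nat \<Rightarrow> nat \<Rightarrow> nat \<Rightarrow> int \<Rightarrow> bool" where
  "quadrant_bound p q i j v \<longleftrightarrow>
     int (min p q) - 1 \<le> v \<and>
     (i = j \<or> i < j \<and> Suc i < p \<or> j < i \<and> Suc j < q \<or> min p q \<le> min i j \<longrightarrow>
        int (min p q) \<le> v) \<and>
     (p = 0 \<longrightarrow> int q - 1 \<le> v) \<and> (q = 0 \<longrightarrow> int p - 1 \<le> v) \<and>
     (p = 1 \<and> i = 0 \<and> 0 < j \<and> j < q \<longrightarrow> 1 \<le> v) \<and>
     (q = 1 \<and> j = 0 \<and> 0 < i \<and> i < p \<longrightarrow> 1 \<le> v)"

lemma quadrant_bound_swap: "quadrant_bound q p j i v \<longleftrightarrow> quadrant_bound p q i j v"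
  unfolding quadrant_bound_def by (simp add: min.commute) blast

text \<open>
  Consecutive vertices of an antidiagonal without defects above it alternate between reached and
  not reached. Hence antidiagonal \<open>d\<close> yields a defect if \<open>d\<close> is odd and its two ends on the arms
  agree, and antidiagonal \<open>p + q + 1 - d\<close>, whose ends lie outside the grid, does so if \<open>d\<close> is even.
\<close>

lemma quadrant_bound_defects_le:
  fixes p q i j :: nat and r :: "nat \<Rightarrow> nat \<Rightarrow> bool"
  assumes ij: "i \<le> p" "j \<le> q" "i \<le> j"
    and ry: "\<And>y. y \<le> p \<Longrightarrow> r 0 y \<longleftrightarrow> y \<le> i"
    and rx: "\<And>c. c \<le> q \<Longrightarrow> r c 0 \<longleftrightarrow> c \<le> j"
  shows "quadrant_bound p q i j (defects q p r + int (p - i - 1) + int (q - j - 1))"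
proof -
  let ?v = "defects q p r + int (p - i - 1) + int (q - j - 1)"
  define E where "E = (\<lambda>c y. q < c \<or> p < y \<or> r c y)"
  define m where "m = min p q"
  \<comment> \<open>\<open>A\<close> collects the \<open>d\<close> that yield a defect, on
    antidiagonal \<open>lev d\<close>. As \<open>i \<le> j\<close>, what remains of
    \<open>{1..m}\<close> is \<open>B\<close>, the odd \<open>d\<close> whose two ends
    disagree.\<close>
  define A where "A = {d \<in> {1..m}. even d \<or> (d \<le> i \<longleftrightarrow> d \<le> j)}"
  define B where "B = {d \<in> {1..m}. odd d \<and> i < d \<and> d \<le> j}"
  define lev where "lev = (\<lambda>d. if even d then p + q + 1 - d else d)"
  have m: "m \<le> p" "m \<le> q" by (auto simp: m_def)
  \<comment> \<open>For even \<open>d\<close>, \<open>lev d\<close> is at least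
    \<open>p + q + 1 - m\<close>, which exceeds \<open>m\<close>, so near and far antidiagonals do
    not collide.\<close>
  have "inj_on lev A"
    using m by (auto simp: inj_on_def lev_def A_def split: if_splits)
  have "int (card (lev ` A)) \<le> defects q p r"
  proof (rule card_le_defects)
    show "lev ` A \<subseteq> {1..p + q}"
      using m by (auto simp: lev_def A_def)
  next
    fix d' assume "d' \<in> lev ` A"
    then obtain d where d: "d' = lev d" "1 \<le> d" "d \<le> m" "even d \<or> (d \<le> i \<longleftrightarrow> d \<le> j)"
      by (auto simp: A_def)
    have "\<exists>c y. c + y = Suc d' \<and> 1 \<le> c \<and> c \<le> Suc q \<and> 1 \<le> y \<and> y \<le> Suc p \<and> E (c - 1) y = E c (y - 1)"
    proof (cases "even d")
      case True
      then have d': "d' = p + q + 1 - d" using d by (simp add: lev_def)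
      \<comment> \<open>The ends \<open>(q - d, p + 1)\<close> and \<open>(q + 1, p - d)\<close> are
        outside the grid, hence count as reached, and are \<open>Suc d\<close> steps apart, an odd
        number.\<close>
      have "q - d + Suc d \<le> d'" "E (q - d + Suc d) (d' - (q - d + Suc d))" "E (q - d) (d' - (q - d))"
        using d m d' by (auto simp: E_def)
      then obtain c y where cy: "c + y = Suc d'" "Suc (q - d) \<le> c" "c \<le> q - d + Suc d"
        "E (c - 1) y = E c (y - 1)"
        using ex_level_defect[of "q - d" "Suc d" d' E] True by auto
      then show ?thesis
        using d d' m by (intro exI[of _ c] exI[of _ y]) auto
    next
      case False
      then have d': "d' = d" using d by (simp add: lev_def)
      have "E d 0 \<longleftrightarrow> E 0 d" using False d m rx[of d] ry[of d] by (auto simp: E_def)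
      then obtain c y where cy: "c + y = Suc d" "Suc 0 \<le> c" "c \<le> d" "E (c - 1) y = E c (y - 1)"
        using ex_level_defect[of 0 d d E] False by auto
      then show ?thesis
        using d d' m by (intro exI[of _ c] exI[of _ y]) auto
    qed
    then show "\<exists>c y. c + y = Suc d' \<and> 1 \<le> c \<and> c \<le> Suc q \<and> 1 \<le> y \<and> y \<le> Suc p \<and>
        (q < c - 1 \<or> p < y \<or> r (c - 1) y) = (q < c \<or> p < y - 1 \<or> r c (y - 1))"
      by (simp add: E_def)
  qed
  then have cA: "int (card A) \<le> defects q p r"
    using card_image[OF \<open>inj_on lev A\<close>] by simp
  have AB: "A \<union> B = {1..m}" "A \<inter> B = {}" using ij by (auto simp: A_def B_def)
  have "finite A" "finite B" by (auto simp: A_def B_def)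
  then have "card A + card B = m"
    using card_Un_disjoint[of A B] AB by simp
  then have v: "int m - int (card B) + int (p - i - 1) \<le> ?v" using cA by linarith
  \<comment> \<open>\<open>B\<close> has at most \<open>p - i\<close> elements and the wasted
    vertices make up for \<open>p - i - 1\<close> of them, so at most one unit is lost.\<close>
  have Bsub: "B \<subseteq> {Suc i..p}" using m by (auto simp: B_def)
  then have "card B \<le> p - i" using card_mono[of "{Suc i..p}" B] by simp
  then have 1: "int m - 1 \<le> ?v" using v by linarith
  have 2: "int m \<le> ?v" if c: "i = j \<or> i < j \<and> Suc i < p \<or> m \<le> min i j"
  proof (cases "i = j \<or> m \<le> min i j")
    case True
    then have "B = {}" by (auto simp: B_def)
    then show ?thesis using v by simp
  next
    case False
    then have ip: "Suc i < p" using c by blast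
    \<comment> \<open>An even number in \<open>{Suc i..p}\<close>, which \<open>B\<close> therefore
      misses; this regains the lost unit.\<close>
    define e where "e = (if even (Suc i) then Suc i else Suc (Suc i))"
    have e: "even e" "e \<in> {Suc i..p}" using ip by (auto simp: e_def)
    then have "B \<subseteq> {Suc i..p} - {e}" using Bsub by (auto simp: B_def)
    then have "card B \<le> p - i - 1"
      using card_mono[of "{Suc i..p} - {e}" B] e(2) by simp
    then show ?thesis using v by linarith
  qed
  \<comment> \<open>In a degenerate quadrant the defects are the \<open>j\<close> reached border
    vertices of the other arm; with \<open>q - j - 1\<close> wasted ones they make at least
    \<open>q - 1\<close>.\<close>
  have 3: "int q - 1 \<le> ?v" if "p = 0"
    using that sum_of_bool_le[of j q "\<lambda>c. r c 0"] ij rx by (simp add: defects_def del: sum_of_bool_eq)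
  have 4: "int p - 1 \<le> ?v" if "q = 0"
    using that sum_of_bool_le[of i p "r 0"] ij ry by (simp add: defects_def del: sum_of_bool_eq)
  have 5: "1 \<le> ?v" if c: "p = 1" "i = 0" "0 < j" "j < q"
  proof -
    \<comment> \<open>On antidiagonal \<open>Suc j\<close>, the first unreached arm vertex
      \<open>(Suc j, 0)\<close> is two steps from \<open>(j - 1, 2)\<close>, which is outside the
      grid and counts as reached; alternation would make them agree.\<close>
    have "int (card {Suc j}) \<le> defects q p r"
    proof (rule card_le_defects)
      fix d assume "d \<in> {Suc j}"
      then have d: "d = Suc j" by simp
      obtain k where k: "j = Suc k" using c by (cases j) auto
      have "\<not> E (k + 2) 0" "E k 2" using c k rx[of "k + 2"] by (auto simp: E_def)
      then obtain c y where cy: "c + y = Suc (k + 2)" "Suc k \<le> c" "c \<le> k + 2"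
        "E (c - 1) y = E c (y - 1)"
        using ex_level_defect[of k 2 "k + 2" E] by auto
      then have "c + y = Suc d \<and> 1 \<le> c \<and> c \<le> Suc q \<and> 1 \<le> y \<and> y \<le> Suc p \<and> E (c - 1) y = E c (y - 1)"
        using c d k by simp
      then show "\<exists>c y. c + y = Suc d \<and> 1 \<le> c \<and> c \<le> Suc q \<and> 1 \<le> y \<and> y \<le> Suc p \<and>
        (q < c - 1 \<or> p < y \<or> r (c - 1) y) = (q < c \<or> p < y - 1 \<or> r c (y - 1))"
        unfolding E_def by blast
    qed (use c in auto)
    then show ?thesis by simp
  qed
  show ?thesis
    unfolding quadrant_bound_def m_def[symmetric]
    using 1 2 3 4 5 ij by auto
qed

lemma quadrant_bound_defects:
  fixes p q i j :: nat and r :: "nat \<Rightarrow> nat \<Rightarrow> bool"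
  assumes "i \<le> p" "j \<le> q"
    and "\<And>y. y \<le> p \<Longrightarrow> r 0 y \<longleftrightarrow> y \<le> i"
    and "\<And>c. c \<le> q \<Longrightarrow> r c 0 \<longleftrightarrow> c \<le> j"
  shows "quadrant_bound p q i j (defects q p r + int (p - i - 1) + int (q - j - 1))"
proof (cases "i \<le> j")
  case True
  then show ?thesis using quadrant_bound_defects_le[OF assms(1,2) _ assms(3,4)] by simp
next
  case False
  then have "quadrant_bound q p j i (defects p q (\<lambda>c y. r y c) + int (q - j - 1) + int (p - i - 1))"
    using quadrant_bound_defects_le[OF assms(2,1) _ assms(4,3)] by simp
  moreover have "defects p q (\<lambda>c y. r y c) + int (q - j - 1) + int (p - i - 1)
      = defects q p r + int (p - i - 1) + int (q - j - 1)"
    using defects_swap[of p q r] by linarith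
  ultimately show ?thesis using quadrant_bound_swap by metis
qed

section \<open>Combining the four quadrants\<close>

text \<open>With \<open>l\<close> the shortest arm, the minima add up to
  \<open>2 * l + n - 1\<close>, so the basic bounds give \<open>2 * l + n - 5\<close>, enough for
  \<open>l \<ge> 2\<close>. For \<open>l = 1\<close> one more unit is needed; for
  \<open>l = 0\<close> the clauses for degenerate quadrants give \<open>2 * n - 6\<close>, where
  \<open>4 \<le> n\<close> enters.\<close>

lemma quadrant_bounds_sum_le:
  fixes l r u d il ir iu id :: nat
  assumes n: "4 \<le> n" "l + r = n - 1" "u + d = n - 1"
    and le: "l \<le> r" "l \<le> u" "u \<le> d"
    and arms: "il \<le> l" "ir \<le> r" "iu \<le> u" "id \<le> d"
    and lu: "quadrant_bound l u il iu v1" and ld: "quadrant_bound l d il id v2"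
    and ru: "quadrant_bound r u ir iu v3" and rd: "quadrant_bound r d ir id v4"
  shows "int n - 2 \<le> v1 + v2 + v3 + v4"
proof -
  have mins: "min l u = l" "min l d = l" "min r u = u" "min r d = d"
    using n le by auto
  have base: "int l - 1 \<le> v1" "int l - 1 \<le> v2" "int u - 1 \<le> v3" "int d - 1 \<le> v4"
    using lu ld ru rd by (auto simp: quadrant_bound_def mins)
  have good1: "il = iu \<or> il < iu \<and> Suc il < l \<or> iu < il \<and> Suc iu < u \<or> l \<le> min il iu \<Longrightarrow> int l \<le> v1"
    using lu unfolding quadrant_bound_def mins by blast
  have good2: "id < il \<and> Suc id < d \<or> l \<le> min il id \<Longrightarrow> int l \<le> v2"
    using ld unfolding quadrant_bound_def mins by blast
  have good3: "ir < iu \<and> Suc ir < r \<or> u \<le> min ir iu \<Longrightarrow> int u \<le> v3"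
    using ru unfolding quadrant_bound_def mins by blast
  consider "l = 0" | "2 \<le> l" | "l = 1" "u = 1" | "l = 1" "2 \<le> u" using le by linarith
  then show ?thesis
  proof cases
    case 1
    have "int u - 1 \<le> v1" "int d - 1 \<le> v2"
      using lu ld 1 by (auto simp: quadrant_bound_def)
    moreover have "0 \<le> v1" "0 \<le> v3" if "u = 0"
      using lu ru base that n 1 arms by (auto simp: quadrant_bound_def)
    ultimately show ?thesis using base 1 n by (cases "u = 0") linarith+
  next
    case 2
    then show ?thesis using base n by linarith
  next
    case 3
    \<comment> \<open>If exactly one of the two short arms is reached, the gain comes from the
      quadrant that it shares with a long arm.\<close>
    have "1 \<le> v1 \<or> 1 \<le> v2 \<or> 1 \<le> v3"
    proof -
      consider "il = iu" | "il = 1" "iu = 0" | "il = 0" "iu = 1" using 3 arms by linarith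
      then show ?thesis
      proof cases
        case 1
        then show ?thesis using good1 3 by simp
      next
        case 2
        then have "int l \<le> v2" using good2 3 n by (cases "id = 0") auto
        then show ?thesis using 3 by simp
      next
        case c: 3
        then have "int u \<le> v3" using good3 3 n by (cases "ir = 0") auto
        then show ?thesis using 3 by simp
      qed
    qed
    then show ?thesis using base 3 n by linarith
  next
    case 4
    \<comment> \<open>The case \<open>il = 0\<close>, \<open>0 < iu < u\<close> is what the clause
      for \<open>p = 1\<close> in \<open>quadrant_bound\<close> is made for.\<close>
    have "int l \<le> v1 \<or> int u \<le> v3"
    proof -
      consider "il = 1" | "il = 0" "iu = 0" | "il = 0" "0 < iu" "iu < u" | "iu = u"
        using 4 arms by linarith
      then show ?thesis
      proof cases
        case 1
        then have "int l \<le> v1" using good1 4 by (cases "iu = 0") auto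
        then show ?thesis ..
      next
        case 2
        then show ?thesis using good1 by simp
      next
        case 3
        then show ?thesis using lu 4 by (simp add: quadrant_bound_def)
      next
        case c: 4
        then have "int u \<le> v3" using good3 4 n le by (cases "ir < u") auto
        then show ?thesis ..
      qed
    qed
    then show ?thesis using base 4 n by linarith
  qed
qed

text \<open>The eight cases are the symmetries of the square: each moves a shortest arm to
  \<open>l\<close> and orders the two arms perpendicular to it.\<close>

lemma quadrant_bounds_sum:
  fixes l r u d il ir iu id :: nat
  assumes n: "4 \<le> n" "l + r = n - 1" "u + d = n - 1"
    and arms: "il \<le> l" "ir \<le> r" "iu \<le> u" "id \<le> d"
    and Q: "quadrant_bound l u il iu v1" "quadrant_bound l d il id v2"
      "quadrant_bound r u ir iu v3" "quadrant_bound r d ir id v4"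
  shows "int n - 2 \<le> v1 + v2 + v3 + v4"
proof -
  have n': "r + l = n - 1" "d + u = n - 1" using n by simp_all
  note Q' = Q Q[THEN quadrant_bound_swap[THEN iffD2]]
  consider "l \<le> r" "l \<le> u" "u \<le> d" | "l \<le> r" "l \<le> d" "d \<le> u"
    | "r \<le> l" "r \<le> u" "u \<le> d" | "r \<le> l" "r \<le> d" "d \<le> u"
    | "u \<le> d" "u \<le> l" "l \<le> r" | "u \<le> d" "u \<le> r" "r \<le> l"
    | "d \<le> u" "d \<le> l" "l \<le> r" | "d \<le> u" "d \<le> r" "r \<le> l"
    using linear[of l r] linear[of u d] linear[of l u] linear[of l d] linear[of r u] linear[of r d]
    by blast
  then show ?thesis
  proof cases
    case 1
    then show ?thesis using quadrant_bounds_sum_le[of n l r u d] n arms Q' by blast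
  next
    case 2
    then have "int n - 2 \<le> v2 + v1 + v4 + v3"
      using quadrant_bounds_sum_le[of n l r d u] n n' arms Q' by blast
    then show ?thesis by linarith
  next
    case 3
    then have "int n - 2 \<le> v3 + v4 + v1 + v2"
      using quadrant_bounds_sum_le[of n r l u d] n n' arms Q' by blast
    then show ?thesis by linarith
  next
    case 4
    then have "int n - 2 \<le> v4 + v3 + v2 + v1"
      using quadrant_bounds_sum_le[of n r l d u] n n' arms Q' by blast
    then show ?thesis by linarith
  next
    case 5
    then have "int n - 2 \<le> v1 + v3 + v2 + v4"
      using quadrant_bounds_sum_le[of n u d l r] n arms Q' by blast
    then show ?thesis by linarith
  next
    case 6
    then have "int n - 2 \<le> v3 + v1 + v4 + v2"
      using quadrant_bounds_sum_le[of n u d r l] n n' arms Q' by blast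
    then show ?thesis by linarith
  next
    case 7
    then have "int n - 2 \<le> v2 + v4 + v1 + v3"
      using quadrant_bounds_sum_le[of n d u l r] n n' arms Q' by blast
    then show ?thesis by linarith
  next
    case 8
    then have "int n - 2 \<le> v4 + v2 + v3 + v1"
      using quadrant_bounds_sum_le[of n d u r l] n n' arms Q' by blast
    then show ?thesis by linarith
  qed
qed

subsection \<open>The upper bound\<close>

lemma sum_split_at:
  fixes f :: "nat \<Rightarrow> int"
  assumes "a < n"
  shows "sum f {..<n} = f a + (\<Sum>c = 1..a. f (a - c)) + (\<Sum>c = 1..n - 1 - a. f (a + c))"
proof -
  have "sum f {..<n} = sum f {..<a} + sum f {a..<n}"
    using assms by (metis sum.atLeastLessThan_concat atLeast0LessThan less_imp_le zero_le)
  also have "sum f {..<a} = (\<Sum>c = 1..a. f (a - c))"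
    by (rule sum.reindex_bij_witness[of _ "\<lambda>c. a - c" "\<lambda>c. a - c"]) auto
  also have "sum f {a..<n} = f a + sum f {Suc a..<n}"
    using assms by (simp add: sum.atLeast_Suc_lessThan)
  also have "sum f {Suc a..<n} = (\<Sum>c = 1..n - 1 - a. f (a + c))"
    by (rule sum.reindex_bij_witness[of _ "\<lambda>c. a + c" "\<lambda>c. c - a"]) auto
  finally show ?thesis by simp
qed

text \<open>On an arm the preceding vertex is the only closer one. So the reached vertices form an
  initial segment, and only \<open>Suc i\<close> can lie in \<open>S\<close>; for
  \<open>i = L\<close> truncation makes both sides \<open>0\<close>.\<close>

lemma arm_count:
  fixes r s :: "nat \<Rightarrow> bool"
  assumes "r 0"
    and step: "\<And>y. 1 \<le> y \<Longrightarrow> y \<le> L \<Longrightarrow> r y \<or> s y \<Longrightarrow> r (y - 1)"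
    and disj: "\<And>y. y \<le> L \<Longrightarrow> s y \<Longrightarrow> \<not> r y"
  obtains i where "i \<le> L" "\<And>y. y \<le> L \<Longrightarrow> r y \<longleftrightarrow> y \<le> i"
    "(\<Sum>y = 1..L. of_bool (s y)) + int (L - i - 1) \<le> int L - int i"
proof -
  define i where "i = Max {y. y \<le> L \<and> r y}"
  have fin: "finite {y. y \<le> L \<and> r y}" by simp
  have ne: "{y. y \<le> L \<and> r y} \<noteq> {}" using \<open>r 0\<close> by auto
  have i: "i \<le> L" "r i" using Max_in[OF fin ne] unfolding i_def by simp_all
  have down: "r z" if "z \<le> y" "y \<le> L" "r y" for y z
    using that
  proof (induction y rule: dec_induct)
    case (step k)
    have "r k" using assms(2)[of "Suc k"] step.prems by simp
    then show ?case using step.IH step.prems by simp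
  qed
  have r: "r y \<longleftrightarrow> y \<le> i" if "y \<le> L" for y
  proof
    assume "r y"
    then show "y \<le> i" unfolding i_def using that by (intro Max_ge[OF fin]) simp
  next
    assume "y \<le> i"
    then show "r y" using down i by blast
  qed
  have "{1..L} \<inter> {y. s y} \<subseteq> (if i < L then {Suc i} else {})"
  proof
    fix y assume "y \<in> {1..L} \<inter> {y. s y}"
    then have y: "1 \<le> y" "y \<le> L" "s y" by auto
    then have "y - 1 \<le> i" "\<not> y \<le> i"
      using step[of y] disj[of y] r[of y] r[of "y - 1"] by auto
    then show "y \<in> (if i < L then {Suc i} else {})" using y by auto
  qed
  then have "card ({1..L} \<inter> {y. s y}) \<le> card (if i < L then {Suc i} else {})"
    by (intro card_mono) auto
  then have "(\<Sum>y = 1..L. of_bool (s y)) + int (L - i - 1) \<le> int L - int i"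
    using i by (auto split: if_splits)
  then show thesis using that i r by blast
qed

text \<open>Two direction flags select one of the four quadrants, so that all share one argument.
  For offsets up to \<open>arm n up a\<close> the coordinate stays in the grid and subtraction does
  not truncate.\<close>

definition shift :: "bool \<Rightarrow> nat \<Rightarrow> nat \<Rightarrow> nat" where
  "shift up a c = (if up then a + c else a - c)"

definition arm :: "nat \<Rightarrow> bool \<Rightarrow> nat \<Rightarrow> nat" where
  "arm n up a = (if up then n - 1 - a else a)"

lemma shift_0 [simp]: "shift up a 0 = a"
  by (simp add: shift_def)

lemma shift_pred:
  assumes "(k - shift s a c) + (shift s a c - k) = 1" "c \<le> arm n s a"
    and "(a - shift s a c) + (shift s a c - a) = Suc ((a - k) + (k - a))"
  shows "1 \<le> c \<and> k = shift s a (c - 1)"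
proof (cases s)
  case True
  then show ?thesis using assms by (simp add: shift_def)
next
  case False
  then show ?thesis using assms by (simp add: shift_def arm_def)
qed

text \<open>Adjacent vertices differ in one coordinate, and a closer one has the smaller offset
  there; this carries \<open>closer\<close> over to the coordinates of
  \<open>quadrant_count\<close>.\<close>

lemma closer_shift:
  assumes "closer (a, b) u (shift s a c, shift t b y)"
    and "c \<le> arm n s a" "y \<le> arm n t b"
  shows "1 \<le> c \<and> u = (shift s a (c - 1), shift t b y) \<or>
         1 \<le> y \<and> u = (shift s a c, shift t b (y - 1))"
proof -
  obtain k l where u: "u = (k, l)" by (cases u)
  define d where "d i j = (i - j) + (j - i)" for i j :: nat
  have sum: "d k (shift s a c) + d l (shift t b y) = 1"
    "d a (shift s a c) + d b (shift t b y) = Suc (d a k + d b l)"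
    using assms(1) by (simp_all add: u closer_def grid_dist_def d_def)
  have d0: "d i j = 0 \<longleftrightarrow> i = j" for i j by (auto simp: d_def)
  consider "d k (shift s a c) = 1" "l = shift t b y" | "d l (shift t b y) = 1" "k = shift s a c"
    using sum(1) by (auto simp: add_is_1 d0)
  then show ?thesis
  proof cases
    case 1
    then have "d a (shift s a c) = Suc (d a k)" using sum(2) by simp
    then show ?thesis using shift_pred[OF 1(1)[unfolded d_def] assms(2)] 1(2) u by (simp add: d_def)
  next
    case 2
    then have "d b (shift t b y) = Suc (d b l)" using sum(2) by simp
    then show ?thesis using shift_pred[OF 2(1)[unfolded d_def] assms(3)] 2(2) u by (simp add: d_def)
  qed
qed

lemma visibility_set_grid_card_le:
  assumes n: "4 \<le> n" and x: "x \<in> pverts (grid n)" and vis: "visibility_set (grid n) x S"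
  shows "2 * card S \<le> n ^ 2 + n - 2"
proof -
  obtain a b where ab: "x = (a, b)" by (cases x)
  then have "a < n" "b < n" using x by (auto simp: pverts_grid)
  obtain R where S: "S \<subseteq> pverts (grid n) - {x}"
    and R: "R \<subseteq> pverts (grid n)" "x \<in> R" "R \<inter> S = {}"
    "\<And>v. v \<in> R \<union> S \<Longrightarrow> v \<noteq> x \<Longrightarrow> \<exists>u\<in>R. closer x u v"
    using vis visibility_set_grid_iff[OF x, of S] by blast
  define r where "r s t c y \<longleftrightarrow> (shift s a c, shift t b y) \<in> R" for s t c y
  define f where "f s t c y \<longleftrightarrow> (shift s a c, shift t b y) \<in> S" for s t c y
  define H where "H s = arm n s a" for s
  define V where "V t = arm n t b" for t
  have HV: "H True = n - 1 - a" "H False = a" "V True = n - 1 - b" "V False = b"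
    by (simp_all add: H_def V_def arm_def)
  have disj: "f s t c y \<Longrightarrow> \<not> r s t c y" for s t c y
    using R(3) by (auto simp: f_def r_def)
  have pred: "1 \<le> c \<and> r s t (c - 1) y \<or> 1 \<le> y \<and> r s t c (y - 1)"
    if "r s t c y \<or> f s t c y" "c \<le> H s" "y \<le> V t" "1 \<le> c \<or> 1 \<le> y" for s t c y
  proof -
    let ?v = "(shift s a c, shift t b y)"
    have "?v \<noteq> x" using that(2-4) by (auto simp: ab shift_def H_def V_def arm_def split: if_splits)
    moreover have "?v \<in> R \<union> S" using that(1) by (auto simp: r_def f_def)
    ultimately obtain u where "u \<in> R" "closer (a, b) u ?v" using R(4) ab by blast
    then show ?thesis
      using closer_shift[of a b u s c t y n] that(2,3) by (auto simp: r_def H_def V_def)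
  qed
  \<comment> \<open>Each arm borders two quadrants. At offset \<open>0\<close> the other flag makes
    no difference, so \<open>True\<close> stands for both; see \<open>rj\<close> and
    \<open>ri\<close>.\<close>
  have "\<exists>j\<le>H s. (\<forall>c\<le>H s. r s True c 0 \<longleftrightarrow> c \<le> j) \<and>
      (\<Sum>c = 1..H s. of_bool (f s True c 0)) + int (H s - j - 1) \<le> int (H s) - int j" for s
  proof (rule arm_count[of "\<lambda>c. r s True c 0" "H s" "\<lambda>c. f s True c 0"])
    show "r s True 0 0" using R(2) ab by (simp add: r_def)
    show "r s True (c - 1) 0" if "1 \<le> c" "c \<le> H s" "r s True c 0 \<or> f s True c 0" for c
      using pred[OF that(3,2)] that(1) by simp
  qed (use disj in blast)+
  then obtain j where j: "j s \<le> H s" "\<And>c. c \<le> H s \<Longrightarrow> r s True c 0 \<longleftrightarrow> c \<le> j s"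
    "(\<Sum>c = 1..H s. of_bool (f s True c 0)) + int (H s - j s - 1) \<le> int (H s) - int (j s)" for s
    by metis
  have "\<exists>i\<le>V t. (\<forall>y\<le>V t. r True t 0 y \<longleftrightarrow> y \<le> i) \<and>
      (\<Sum>y = 1..V t. of_bool (f True t 0 y)) + int (V t - i - 1) \<le> int (V t) - int i" for t
  proof (rule arm_count[of "r True t 0" "V t" "f True t 0"])
    show "r True t 0 0" using R(2) ab by (simp add: r_def)
    show "r True t 0 (y - 1)" if "1 \<le> y" "y \<le> V t" "r True t 0 y \<or> f True t 0 y" for y
      using pred[OF that(3) _ that(2)] that(1) by simp
  qed (use disj in blast)+
  then obtain i where i: "i t \<le> V t" "\<And>y. y \<le> V t \<Longrightarrow> r True t 0 y \<longleftrightarrow> y \<le> i t"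
    "(\<Sum>y = 1..V t. of_bool (f True t 0 y)) + int (V t - i t - 1) \<le> int (V t) - int (i t)" for t
    by metis
  have rj: "r s t c 0 \<longleftrightarrow> c \<le> j s" if "c \<le> H s" for s t c
    using j(2)[OF that] by (simp add: r_def)
  have ri: "r s t 0 y \<longleftrightarrow> y \<le> i t" if "y \<le> V t" for s t y
    using i(2)[OF that] by (simp add: r_def)
  define D where "D s t = defects (H s) (V t) (r s t)" for s t
  define F where "F s t = (\<Sum>c = 1..H s. \<Sum>y = 1..V t. of_bool (f s t c y) :: int)" for s t
  have F: "2 * F s t + D s t \<le> int (H s) * int (V t) + int (j s) + int (i t)" for s t
  proof -
    have "2 * F s t + D s t \<le> int (H s) * int (V t) + (\<Sum>c = 1..H s. of_bool (r s t c 0))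
        + (\<Sum>y = 1..V t. of_bool (r s t 0 y))"
      unfolding F_def D_def
    proof (rule quadrant_count)
      show "r s t (c - 1) y \<or> r s t c (y - 1)"
        if "1 \<le> c" "c \<le> H s" "1 \<le> y" "y \<le> V t" "r s t c y \<or> f s t c y" for c y
        using pred[OF that(5,2,4)] that(1) by auto
    qed (rule disj)
    then show ?thesis
      using sum_of_bool_le[of "j s" "H s" "\<lambda>c. r s t c 0"] sum_of_bool_le[of "i t" "V t" "r s t 0"]
        j(1) i(1) rj ri by (simp del: sum_of_bool_eq)
  qed
  have bound: "quadrant_bound (V t) (H s) (i t) (j s)
      (D s t + int (V t - i t - 1) + int (H s - j s - 1))" for s t
    unfolding D_def using i(1) j(1) ri rj by (intro quadrant_bound_defects) auto
  have total: "int n - 2 \<le>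
      (D False False + int (V False - i False - 1) + int (H False - j False - 1)) +
      (D True False + int (V False - i False - 1) + int (H True - j True - 1)) +
      (D False True + int (V True - i True - 1) + int (H False - j False - 1)) +
      (D True True + int (V True - i True - 1) + int (H True - j True - 1))"
    by (rule quadrant_bounds_sum[OF n _ _ i(1) i(1) j(1) j(1) bound bound bound bound])
      (use HV \<open>a < n\<close> \<open>b < n\<close> in auto)
  have "int (card S) = (\<Sum>c<n. \<Sum>y<n. of_bool ((c, y) \<in> S))"
  proof -
    have "S = ({..<n} \<times> {..<n}) \<inter> {z. z \<in> S}" using S by (auto simp: pverts_grid)
    then have "int (card S) = (\<Sum>z\<in>{..<n} \<times> {..<n}. of_bool (z \<in> S))" by simp
    also have "\<dots> = (\<Sum>c<n. \<Sum>y<n. of_bool ((c, y) \<in> S))"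
      by (simp only: sum.cartesian_product split_def prod.collapse)
    finally show ?thesis .
  qed
  also have "\<dots> = F False False + F False True + F True False + F True True
      + (\<Sum>c = 1..H False. of_bool (f False True c 0)) + (\<Sum>c = 1..H True. of_bool (f True True c 0))
      + (\<Sum>y = 1..V False. of_bool (f True False 0 y)) + (\<Sum>y = 1..V True. of_bool (f True True 0 y))"
  proof -
    let ?I = "\<lambda>P. of_bool P :: int"
    have inner: "(\<Sum>y<n. ?I ((c, y) \<in> S)) = ?I ((c, b) \<in> S) + (\<Sum>y = 1..b. ?I ((c, b - y) \<in> S))
        + (\<Sum>y = 1..n - 1 - b. ?I ((c, b + y) \<in> S))" for c
      by (rule sum_split_at[OF \<open>b < n\<close>])
    have "(a, b) \<notin> S" using S ab by auto
    then show ?thesis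
      unfolding F_def f_def HV shift_def
        sum_split_at[OF \<open>a < n\<close>, of "\<lambda>c. \<Sum>y<n. ?I ((c, y) \<in> S)"]
      unfolding inner
      by (simp add: sum.distrib del: sum_of_bool_eq)
  qed
  finally have card: "int (card S) = \<dots>" .
  have H: "int (H False) + int (H True) = int n - 1" and V: "int (V False) + int (V True) = int n - 1"
    using HV \<open>a < n\<close> \<open>b < n\<close> by auto
  have "(int n - 1)\<^sup>2 = (int (H False) + int (H True)) * (int (V False) + int (V True))"
    unfolding H V power2_eq_square ..
  then have area: "int (H False) * int (V False) + int (H False) * int (V True)
      + int (H True) * int (V False) + int (H True) * int (V True) = (int n - 1)\<^sup>2"
    by (simp only: distrib_left distrib_right add_ac)
  \<comment> \<open>The reached vertices of each arm enter \<open>F\<close> for two quadrants and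
    cancel against twice the arm bounds \<open>j(3)\<close> and \<open>i(3)\<close>. These also
    subtract each wasted vertex twice, just as \<open>total\<close> counts it.\<close>
  have "2 * int (card S) \<le> (int n - 1)\<^sup>2 + 4 * (int n - 1) - (int n - 2)"
    using card total area F[of False False] F[of False True] F[of True False] F[of True True]
      j(3)[of False] j(3)[of True] i(3)[of False] i(3)[of True] H V
    by (smt (verit))
  then have "2 * int (card S) \<le> (int n)\<^sup>2 + int n - 1"
    by (simp add: power2_eq_square algebra_simps)
  then have "2 * card S \<le> n\<^sup>2 + n - 1"
    using n by (simp flip: of_nat_power of_nat_add add: of_nat_diff)
  moreover have "even (n\<^sup>2 + n)" by simp
  ultimately show ?thesis by presburger
qed

subsection \<open>A largest visibility set\<close>

text \<open>
  Rows of the extremal set \<open>S\<close> and of the vertices seen from \<open>(1, 1)\<close>. If \<open>n\<close> is odd, \<open>S\<close> consists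
  of column \<open>0\<close> and the even rows without column \<open>1\<close>. If \<open>n\<close> is even, this would waste the last
  row, so even and odd rows exchange their roles beyond the antidiagonal through \<open>(n - 1, 1)\<close>,
  except in the last column.
\<close>

definition row :: "nat \<Rightarrow> nat \<Rightarrow> nat set" where
  "row n y =
     (if y = 0 \<or> odd n \<and> even y then {..<n} - {1}
      else if y = 1 \<or> odd n then {0}
      else if even y then {0, n - 1} \<union> {2..n - y}
      else {0} \<union> {n - y + 1..n - 2})"

definition seen_row :: "nat \<Rightarrow> nat \<Rightarrow> nat set" where
  "seen_row n y =
     (if y = 1 \<or> odd n \<and> odd y then {1..<n}
      else if y = 0 \<or> odd n then {1}
      else if even y then {1} \<union> {n - y + 1..n - 2}
      else {1..n - y})"

lemma visibility_set_rows:
  assumes n: "4 \<le> n"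
  shows "visibility_set (grid n) (1, 1) (Sigma {..<n} (row n))"
proof -
  let ?S = "Sigma {..<n} (row n)" and ?R = "Sigma {..<n} (seen_row n)"
  have x: "(1, 1) \<in> pverts (grid n)" using n by (simp add: pverts_grid)
  have rows: "row n y \<subseteq> {..<n}" "seen_row n y \<subseteq> {..<n}" "row n y \<inter> seen_row n y = {}"
    if "y < n" for y
    using n that by (auto simp: row_def seen_row_def)
  have left: "closer (1, 1) (y, c - 1) (y, c)" if "2 \<le> c" for y c
    using that by (auto simp: closer_def grid_dist_def)
  have below: "closer (1, 1) (y - 1, c) (y, c)" if "2 \<le> y" for y c
    using that by (auto simp: closer_def grid_dist_def)
  have right: "closer (1, 1) (y, 1) (y, 0)" for y
    by (auto simp: closer_def grid_dist_def)
  have above: "closer (1, 1) (1, c) (0, c)" for c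
    by (auto simp: closer_def grid_dist_def)
  have pred: "\<exists>u\<in>?R. closer (1, 1) u (y, c)"
    if y: "y < n" and c: "c \<in> seen_row n y \<union> row n y" and ne: "(y, c) \<noteq> (1, 1)" for y c
  proof -
    have "c < n" using rows c y by blast
    \<comment> \<open>Column \<open>0\<close> is seen from column \<open>1\<close> and the rest of
      row \<open>0\<close> from row \<open>1\<close>; any other vertex needs a seen vertex before it
      in its row or column.\<close>
    have "c = 0 \<or> y = 0 \<or> 2 \<le> c \<and> c - 1 \<in> seen_row n y \<or> 2 \<le> y \<and> c \<in> seen_row n (y - 1)"
    proof -
      consider "c = 0 \<or> y = 0" | "1 \<le> c" "y = 1" | "1 \<le> c" "2 \<le> y" "odd n"
        | "1 \<le> c" "2 \<le> y" "even n" "even y" | "1 \<le> c" "2 \<le> y" "even n" "odd y"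
        by linarith
      then show ?thesis
      proof cases
        case 2
        then have "2 \<le> c" using ne by auto
        then show ?thesis using 2 \<open>c < n\<close> by (auto simp: seen_row_def)
      next
        case 3
        then show ?thesis
          using c \<open>c < n\<close> by (cases "c = 1"; cases "even y") (auto simp: seen_row_def row_def)
      next
        case 4
        \<comment> \<open>An even row is entered from the preceding odd row while
          \<open>y + c \<le> n + 1\<close> and along itself beyond.\<close>
        then have "c \<in> {1..n - 1}" using \<open>c < n\<close> by auto
        moreover have "seen_row n y = {1} \<union> {n - y + 1..n - 2}" using 4 by (auto simp: seen_row_def)
        moreover have "seen_row n (y - 1) = (if y = 2 then {1..<n} else {1..n - (y - 1)})"
          using 4 by (auto simp: seen_row_def)
        ultimately show ?thesis using 4 y by (cases "c \<le> n - (y - 1)") auto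
      next
        case 5
        then have y3: "3 \<le> y" by (cases "y = 2") auto
        \<comment> \<open>Here the roles are exchanged. The last column drops out, since from row
          \<open>3\<close> on an odd row has neither a seen vertex nor one of \<open>S\<close>
          there.\<close>
        have "c \<in> {1..n - 2}" using c 5 y y3 by (auto simp: seen_row_def row_def)
        moreover have "seen_row n y = {1..n - y}" using 5 by (auto simp: seen_row_def)
        moreover have "seen_row n (y - 1) = {1} \<union> {n - (y - 1) + 1..n - 2}"
          using 5 y3 by (auto simp: seen_row_def)
        ultimately show ?thesis using 5 y by (cases "c \<le> n - y + 1"; cases "c = 1") auto
      qed blast
    qed
    then consider "c = 0" | "1 \<le> c" "y = 0" | "2 \<le> c" "c - 1 \<in> seen_row n y"
      | "1 \<le> c" "2 \<le> y" "c \<in> seen_row n (y - 1)"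
      by linarith
    then show ?thesis
    proof cases
      case 1
      then show ?thesis using right[of y] y n by (intro bexI[of _ "(y, 1)"]) (auto simp: seen_row_def)
    next
      case 2
      then show ?thesis using above[of c] \<open>c < n\<close> n
        by (intro bexI[of _ "(1, c)"]) (auto simp: seen_row_def)
    next
      case 3
      then show ?thesis using left[of c y] y by (intro bexI[of _ "(y, c - 1)"]) auto
    next
      case 4
      then show ?thesis using below[of y c] y by (intro bexI[of _ "(y - 1, c)"]) auto
    qed
  qed
  have "?S \<subseteq> pverts (grid n) - {(1, 1)}"
  proof -
    have "1 \<notin> row n 1" using n by (simp add: row_def)
    then show ?thesis using rows by (auto simp: pverts_grid)
  qed
  moreover have "?R \<subseteq> pverts (grid n) \<and> (1, 1) \<in> ?R \<and> ?R \<inter> ?S = {} \<and>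
      (\<forall>v\<in>?R \<union> ?S. v \<noteq> (1, 1) \<longrightarrow> (\<exists>u\<in>?R. closer (1, 1) u v))"
  proof (intro conjI ballI impI)
    show "?R \<subseteq> pverts (grid n)" using rows by (auto simp: pverts_grid)
    show "(1, 1) \<in> ?R" using n by (simp add: seen_row_def)
    show "?R \<inter> ?S = {}" using rows(3) by auto
    show "\<exists>u\<in>?R. closer (1, 1) u v" if "v \<in> ?R \<union> ?S" "v \<noteq> (1, 1)" for v
      using pred[of "fst v" "snd v"] that by (cases v) auto
  qed
  ultimately show ?thesis
    unfolding visibility_set_grid_iff[OF x] by (rule conjI[OF _ exI[of _ ?R]])
qed

lemma card_row:
  assumes "4 \<le> n" "y < n"
  shows "card (row n y) =
    (if y = 0 \<or> odd n \<and> even y then n - 1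
     else if y = 1 \<or> odd n then 1
     else if even y then n + 1 - y
     else y - 1)"
proof -
  have "y = 0 \<or> y = 1 \<or> 2 \<le> y" by linarith
  then consider (full) "y = 0 \<or> odd n \<and> even y" | (single) "\<not> (y = 0 \<or> odd n \<and> even y)" "y = 1 \<or> odd n"
    | (ev) "2 \<le> y" "even n" "even y" | (od) "2 \<le> y" "even n" "odd y"
    by blast
  then show ?thesis
  proof cases
    case full
    then have "row n y = {..<n} - {1}" by (simp only: row_def if_True)
    then show ?thesis using full assms by simp
  next
    case single
    then show ?thesis by (auto simp: row_def)
  next
    case ev
    then have "row n y = insert 0 (insert (n - 1) {2..n - y})" by (auto simp: row_def)
    then show ?thesis using ev assms by (auto simp: card_insert_if)
  next
    case od
    then have "3 \<le> y" by (cases "y = 2") auto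
    moreover have "row n y = insert 0 {n - y + 1..n - 2}" using od by (auto simp: row_def)
    ultimately show ?thesis using od assms by (auto simp: card_insert_if)
  qed
qed

lemma sum_pairs:
  fixes g :: "nat \<Rightarrow> nat"
  shows "sum g {..<2 * h} = (\<Sum>k<h. g (2 * k) + g (2 * k + 1))"
  by (induction h) simp_all

text \<open>Rows are paired. For even \<open>n\<close>, rows \<open>0\<close> and \<open>1\<close>
  hold \<open>n\<close> vertices and each later pair \<open>n + 1\<close>, since the odd row gains
  what the even row loses. For odd \<open>n\<close> each pair holds \<open>n\<close> and the last
  row \<open>n - 1\<close>.\<close>

lemma card_rows:
  assumes n: "4 \<le> n"
  shows "2 * card (Sigma {..<n} (row n)) = n ^ 2 + n - 2"
proof -
  have "finite (row n y)" for y by (simp add: row_def)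
  then have card: "card (Sigma {..<n} (row n)) = (\<Sum>y<n. card (row n y))"
    by (simp add: card_SigmaI)
  define g where "g y = card (row n y)" for y
  show ?thesis
  proof (cases "even n")
    case True
    define h where "h = n div 2 - 1"
    have h: "n = 2 * Suc h" using True n by (auto simp: h_def elim!: evenE)
    have "(\<Sum>y<n. g y) = g 0 + g 1 + (\<Sum>k<h. g (2 * Suc k) + g (2 * Suc k + 1))"
      unfolding h sum_pairs by (simp add: sum.lessThan_Suc_shift del: sum.lessThan_Suc)
    also have "(\<Sum>k<h. g (2 * Suc k) + g (2 * Suc k + 1)) = (\<Sum>k<h. n + 1)"
    proof (rule sum.cong[OF refl])
      fix k assume "k \<in> {..<h}"
      then show "g (2 * Suc k) + g (2 * Suc k + 1) = n + 1"
        unfolding g_def using n h by (subst (1 2) card_row) auto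
    qed
    also have "g 0 = n - 1" unfolding g_def using card_row[OF n, of 0] n by simp
    also have "g 1 = 1" unfolding g_def using card_row[OF n, of 1] n True by simp
    finally show ?thesis using card h unfolding g_def
      by (simp add: power2_eq_square algebra_simps)
  next
    case False
    define h where "h = n div 2"
    have h: "n = Suc (2 * h)" using False by (auto simp: h_def elim!: oddE)
    have "(\<Sum>y<n. g y) = (\<Sum>k<h. g (2 * k) + g (2 * k + 1)) + g (2 * h)"
      unfolding h by (simp add: sum_pairs)
    also have "(\<Sum>k<h. g (2 * k) + g (2 * k + 1)) = (\<Sum>k<h. n)"
    proof (rule sum.cong[OF refl])
      fix k assume "k \<in> {..<h}"
      then show "g (2 * k) + g (2 * k + 1) = n"
        unfolding g_def using n h by (subst (1 2) card_row) auto
    qed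
    also have "g (2 * h) = n - 1" unfolding g_def using card_row[OF n, of "2 * h"] n h by auto
    finally show ?thesis using card h unfolding g_def
      by (simp add: power2_eq_square algebra_simps)
  qed
qed

theorem theorem4p2:
  fixes n :: nat
  assumes "n \<ge> 4"
  shows "real (vv (path_graph n \<box> path_graph n)) = (real n ^ 2 + real n - 2) / 2"
proof -
  define k where "k = card (Sigma {..<n} (row n))"
  have k: "2 * k = n ^ 2 + n - 2"
    using card_rows assms by (simp add: k_def)
  have fin: "finite (pverts (grid n))" and one: "(1, 1) \<in> pverts (grid n)"
    using assms by (simp_all add: pverts_grid)
  note sizes = finite_card_visibility_sets[OF fin]
  have le: "vertex_visibility (grid n) x \<le> k" if "x \<in> pverts (grid n)" for x
    unfolding vertex_visibility_def
  proof (rule Max.boundedI[OF sizes])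
    fix s assume "s \<in> {card S |S. visibility_set (grid n) x S}"
    then obtain S where "s = card S" "visibility_set (grid n) x S" by blast
    then have "2 * s \<le> 2 * k"
      using visibility_set_grid_card_le[OF assms that] k by simp
    then show "s \<le> k" by simp
  qed
  have "k \<le> vertex_visibility (grid n) (1, 1)"
    unfolding vertex_visibility_def k_def
    using visibility_set_rows[OF assms] by (intro Max_ge[OF sizes(1)]) blast
  then have "vv (grid n) = k"
    unfolding vv_def using fin one le by (intro Max_eqI) (auto intro!: image_eqI dest: le intro: antisym)
  moreover have "real (2 * k) = real n ^ 2 + real n - 2"
    unfolding k using assms by (simp add: of_nat_diff)
  ultimately show ?thesis by simp
qed

end
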